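(* Let $\tau$ be a faithful tracial state on $\mathcal{A}=\bigoplus_{k=1}^N\mathcal{M}_{d_k}$, let $\mathcal{B},\mathcal{C}\subseteq\mathcal{A}$ be unital C*-subalgebras that are unitarily equivalent with respect to $\mathcal{A}$, and let $\mu\in(0,\infty)$. The following are equivalent. (1) $\mu\|A\|_{\mathrm{op}}\le\|A\|_{\tau,\mathcal{B}}$ for all $A\in\mathcal{A}$. (2) $\mu\|A\|_{\mathrm{op}}\le\|A\|_{\tau,\mathcal{C}}$ for all $A\in\mathcal{A}$.
   Context: $\mathcal{M}_n$ is the C*-algebra of complex $n\times n$ matrices with the operator norm. $\bigoplus_{k=1}^N\mathcal{M}_{d_k}$ ($N,d_k\in\{1,2,\ldots\}$) is a unital C*-algebra with coordinatewise operations, and its norm $\|\cdot\|_{\mathrm{op}}$ is the maximum of the operator norms of the coordinates. A unital C*-subalgebra contains the unit of the ambient algebra. Subalgebras $\mathcal{B},\mathcal{C}\subseteq\mathcal{A}$ are unitarily equivalent with respect to $\mathcal{A}$ if there is a unitary $U\in\mathcal{A}$ such that $B\mapsto UBU^*$ is a bijection from $\mathcal{B}$ onto $\mathcal{C}$. A state is a positive linear functional of norm $1$; it is faithful if $\tau(A^*A)=0\iff A=0$ and tracial if $\tau(AB)=\tau(BA)$. For a unital C*-subalgebra $\mathcal{D}\subseteq\mathcal{A}$, $P^\tau_{\mathcal{D}}:\mathcal{A}\to\mathcal{D}$ denotes the unique conditional expectation onto $\mathcal{D}$ (linear map $P$ with $P(D)=D$ for $D\in\mathcal{D}$ and $\|P(A)\|_{\mathrm{op}}\le\|A\|_{\mathrm{op}}$)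 such that $\tau\circ P^\tau_{\mathcal{D}}=\tau$; equivalently, the orthogonal projection onto $\mathcal{D}$ for the inner product $\langle A,B\rangle_\tau=\tau(B^*A)$. The Frobenius--Rieffel norm is $\|A\|_{\tau,\mathcal{D}}=\sqrt{\|P^\tau_{\mathcal{D}}(A^*A)\|_{\mathrm{op}}}$. *)

theory Defs
  imports
    "HOL-Library.FuncSet"
    "HOL-Library.Function_Algebras"
    "HOL-Analysis.L2_Norm"
    "Jordan_Normal_Form.Schur_Decomposition"
begin

text \<open>
  An element of the direct sum of the matrix algebras of sizes \<open>d k\<close>, with \<open>k\<close> in a finite
  index type, is the family of its coordinates.  Sums and products of families are the
  pointwise ones of Function_Algebras.
\<close>

definition matrix_sum :: "('n \<Rightarrow> nat) \<Rightarrow> ('n \<Rightarrow> complex mat) set" where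
  "matrix_sum d = {A. \<forall>k. A k \<in> carrier_mat (d k) (d k)}"

definition sum_zero :: "('n \<Rightarrow> nat) \<Rightarrow> 'n \<Rightarrow> complex mat" where
  "sum_zero d = (\<lambda>k. 0\<^sub>m (d k) (d k))"

definition sum_one :: "('n \<Rightarrow> nat) \<Rightarrow> 'n \<Rightarrow> complex mat" where
  "sum_one d = (\<lambda>k. 1\<^sub>m (d k))"

definition sum_smult :: "complex \<Rightarrow> ('n \<Rightarrow> complex mat) \<Rightarrow> 'n \<Rightarrow> complex mat" where
  "sum_smult c A = (\<lambda>k. c \<cdot>\<^sub>m A k)"

definition sum_adj :: "('n \<Rightarrow> complex mat) \<Rightarrow> 'n \<Rightarrow> complex mat" where
  "sum_adj A = (\<lambda>k. mat_adjoint (A k))"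

definition vec_l2_norm :: "complex vec \<Rightarrow> real" where
  "vec_l2_norm v = L2_set (\<lambda>i. cmod (v $ i)) {..<dim_vec v}"

definition mat_op_norm :: "complex mat \<Rightarrow> real" where
  "mat_op_norm M =
     (SUP v \<in> {v \<in> carrier_vec (dim_col M). vec_l2_norm v \<le> 1}. vec_l2_norm (M *\<^sub>v v))"

definition op_norm :: "('n::finite \<Rightarrow> complex mat) \<Rightarrow> real" where
  "op_norm A = Max (range (\<lambda>k. mat_op_norm (A k)))"

text \<open>The last clause of the following definition says that \<open>D\<close> is closed in norm.\<close>

definition unital_cstar_subalgebra ::
  "('n::finite \<Rightarrow> nat) \<Rightarrow> ('n \<Rightarrow> complex mat) set \<Rightarrow> bool" where
  "unital_cstar_subalgebra d D \<longleftrightarrow>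
     D \<subseteq> matrix_sum d \<and> sum_one d \<in> D \<and>
     (\<forall>A\<in>D. \<forall>B\<in>D. A + B \<in> D) \<and>
     (\<forall>c. \<forall>A\<in>D. sum_smult c A \<in> D) \<and>
     (\<forall>A\<in>D. \<forall>B\<in>D. A * B \<in> D) \<and>
     (\<forall>A\<in>D. sum_adj A \<in> D) \<and>
     (\<forall>X. \<forall>A\<in>matrix_sum d. (\<forall>i::nat. X i \<in> D) \<longrightarrow>
        (\<lambda>i. op_norm (X i - A)) \<longlonglongrightarrow> 0 \<longrightarrow> A \<in> D)"

definition unitary_elem :: "('n \<Rightarrow> nat) \<Rightarrow> ('n \<Rightarrow> complex mat) \<Rightarrow> bool" where
  "unitary_elem d U \<longleftrightarrow>
     U \<in> matrix_sum d \<and> sum_adj U * U = sum_one d \<and> U * sum_adj U = sum_one d"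

definition unitarily_equivalent ::
  "('n \<Rightarrow> nat) \<Rightarrow> ('n \<Rightarrow> complex mat) set \<Rightarrow> ('n \<Rightarrow> complex mat) set \<Rightarrow> bool" where
  "unitarily_equivalent d B C \<longleftrightarrow>
     (\<exists>U. unitary_elem d U \<and> bij_betw (\<lambda>X. U * X * sum_adj U) B C)"

definition linear_functional ::
  "('n \<Rightarrow> nat) \<Rightarrow> (('n \<Rightarrow> complex mat) \<Rightarrow> complex) \<Rightarrow> bool" where
  "linear_functional d \<tau> \<longleftrightarrow>
     (\<forall>A\<in>matrix_sum d. \<forall>B\<in>matrix_sum d. \<tau> (A + B) = \<tau> A + \<tau> B) \<and>
     (\<forall>c. \<forall>A\<in>matrix_sum d. \<tau> (sum_smult c A) = c * \<tau> A)"

definition functional_norm ::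
  "('n::finite \<Rightarrow> nat) \<Rightarrow> (('n \<Rightarrow> complex mat) \<Rightarrow> complex) \<Rightarrow> real" where
  "functional_norm d \<tau> = (SUP A \<in> {A \<in> matrix_sum d. op_norm A \<le> 1}. cmod (\<tau> A))"

text \<open>
  In the order on the complex numbers from Complex_Order, \<open>0 \<le> z\<close> means that \<open>z\<close> is real
  and nonnegative.
\<close>

definition state ::
  "('n::finite \<Rightarrow> nat) \<Rightarrow> (('n \<Rightarrow> complex mat) \<Rightarrow> complex) \<Rightarrow> bool" where
  "state d \<tau> \<longleftrightarrow> linear_functional d \<tau> \<and>
     (\<forall>A\<in>matrix_sum d. 0 \<le> \<tau> (sum_adj A * A)) \<and> functional_norm d \<tau> = 1"

definition faithful ::
  "('n \<Rightarrow> nat) \<Rightarrow> (('n \<Rightarrow> complex mat) \<Rightarrow> complex) \<Rightarrow> bool" where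
  "faithful d \<tau> \<longleftrightarrow> (\<forall>A\<in>matrix_sum d. \<tau> (sum_adj A * A) = 0 \<longleftrightarrow> A = sum_zero d)"

definition tracial ::
  "('n \<Rightarrow> nat) \<Rightarrow> (('n \<Rightarrow> complex mat) \<Rightarrow> complex) \<Rightarrow> bool" where
  "tracial d \<tau> \<longleftrightarrow> (\<forall>A\<in>matrix_sum d. \<forall>B\<in>matrix_sum d. \<tau> (A * B) = \<tau> (B * A))"

text \<open>
  Maps out of the direct sum are taken to be extensional, so that a conditional expectation
  is determined by its values on the direct sum and the description below can be unique.
\<close>

definition conditional_expectation ::
  "('n::finite \<Rightarrow> nat) \<Rightarrow> ('n \<Rightarrow> complex mat) set \<Rightarrow>
     (('n \<Rightarrow> complex mat) \<Rightarrow> 'n \<Rightarrow> complex mat) \<Rightarrow> bool" where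
  "conditional_expectation d D P \<longleftrightarrow>
     P \<in> matrix_sum d \<rightarrow>\<^sub>E D \<and>
     (\<forall>A\<in>matrix_sum d. \<forall>B\<in>matrix_sum d. P (A + B) = P A + P B) \<and>
     (\<forall>c. \<forall>A\<in>matrix_sum d. P (sum_smult c A) = sum_smult c (P A)) \<and>
     (\<forall>A\<in>D. P A = A) \<and>
     (\<forall>A\<in>matrix_sum d. op_norm (P A) \<le> op_norm A)"

definition cond_exp ::
  "('n::finite \<Rightarrow> nat) \<Rightarrow> (('n \<Rightarrow> complex mat) \<Rightarrow> complex) \<Rightarrow> ('n \<Rightarrow> complex mat) set \<Rightarrow>
     ('n \<Rightarrow> complex mat) \<Rightarrow> 'n \<Rightarrow> complex mat" where
  "cond_exp d \<tau> D =
     (THE P. conditional_expectation d D P \<and> (\<forall>A\<in>matrix_sum d. \<tau> (P A) = \<tau> A))"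

definition frobenius_rieffel_norm ::
  "('n::finite \<Rightarrow> nat) \<Rightarrow> (('n \<Rightarrow> complex mat) \<Rightarrow> complex) \<Rightarrow> ('n \<Rightarrow> complex mat) set \<Rightarrow>
     ('n \<Rightarrow> complex mat) \<Rightarrow> real" where
  "frobenius_rieffel_norm d \<tau> D A = sqrt (op_norm (cond_exp d \<tau> D (sum_adj A * A)))"

end

theory Submission
  imports Defs
begin

text \<open>
  Conjugation by the unitary \<open>U\<close> carries a \<open>\<tau>\<close>-preserving conditional expectation onto \<open>\<B>\<close> to one
  onto \<open>\<C>\<close>, so the two norms correspond as soon as such an expectation is unique.

  Uniqueness is obtained from the norm bound alone.  A trace is a weighted sum of diagonal entries, so
  \<open>|\<tau> (W A W*)| \<le> \<parallel>A\<parallel> \<tau> (W W*)\<close>.  For self-adjoint \<open>H\<close>, applying this to \<open>P (1 + i t H)\<close>, whose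
  norm is \<open>1 + O(t\<^sup>2)\<close>, shows that \<open>P H\<close> is self-adjoint.  For self-adjoint \<open>G\<close> and \<open>H\<close> the elements
  \<open>1 - i t G - t\<^sup>2 G\<^sup>2 / 2\<close> and \<open>1 + i t H - t\<^sup>2 H\<^sup>2 / 2\<close> have norm \<open>1 + O(t\<^sup>4)\<close>, so the coefficient of
  \<open>t\<^sup>2\<close> in the trace of the first times \<open>P\<close> of the second gives
  \<open>2 Re \<tau> (G P H) \<le> \<tau> (H\<^sup>2) + \<tau> (G\<^sup>2)\<close>.  Replacing \<open>H\<close> by \<open>H + s E\<close> and \<open>G\<close> by \<open>s E\<close> with \<open>E\<close> in the
  subalgebra, and letting \<open>s\<close> vary, yields \<open>Re \<tau> (E P H) = Re \<tau> (E H)\<close>.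
\<close>

section \<open>Operator norm of matrices\<close>

lemma vec_l2_norm_nonneg [simp]: "0 \<le> vec_l2_norm v"
  by (simp add: vec_l2_norm_def)

lemma vec_l2_norm_square: "complex_of_real ((vec_l2_norm v)\<^sup>2) = v \<bullet>c v"
  by (simp add: vec_l2_norm_def L2_set_def sum_nonneg scalar_prod_def
      atLeast0LessThan flip: complex_norm_square)

lemma vec_l2_norm_smult: "vec_l2_norm (c \<cdot>\<^sub>v v) = cmod c * vec_l2_norm v"
  by (auto simp: vec_l2_norm_def norm_mult L2_set_right_distrib intro!: L2_set_cong)

lemma vec_l2_norm_eq_0D:
  assumes "vec_l2_norm v = 0" and "i < dim_vec v"
  shows "v $ i = 0"
  using assms by (simp add: vec_l2_norm_def L2_set_eq_0_iff)

lemma vec_Cauchy_Schwarz: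
  assumes "dim_vec v = dim_vec w"
  shows "cmod (v \<bullet>c w) \<le> vec_l2_norm v * vec_l2_norm w"
proof -
  have "cmod (v \<bullet>c w) \<le> (\<Sum>i<dim_vec v. cmod (v $ i) * cmod (w $ i))"
    using assms by (auto simp: scalar_prod_def atLeast0LessThan norm_mult intro!: sum_norm_le)
  also have "\<dots> \<le> vec_l2_norm v * vec_l2_norm w"
    using assms L2_set_mult_ineq[of "\<lambda>i. cmod (v $ i)" "\<lambda>i. cmod (w $ i)" "{..<dim_vec v}"]
    by (simp add: vec_l2_norm_def)
  finally show ?thesis .
qed

text \<open>Entries of a vector in the unit ball have modulus at most 1, so the sum of the moduli of
  all entries of \<open>M\<close> bounds every \<open>M *\<^sub>v v\<close>. A real
  \<open>SUP\<close> can be compared with its members only once such a bound is known.\<close>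

lemma mat_op_norm_bdd_above:
  "bdd_above ((\<lambda>v. vec_l2_norm (M *\<^sub>v v)) `
     {v \<in> carrier_vec (dim_col M). vec_l2_norm v \<le> 1})"
proof (rule bdd_aboveI2)
  fix v assume "v \<in> {v \<in> carrier_vec (dim_col M). vec_l2_norm v \<le> 1}"
  then have v: "v \<in> carrier_vec (dim_col M)" and le: "vec_l2_norm v \<le> 1" by auto
  have vj: "cmod (v $ j) \<le> 1" if "j < dim_col M" for j
    using member_le_L2_set[of "{..<dim_vec v}" j "\<lambda>i. cmod (v $ i)"] that v le
    by (simp add: vec_l2_norm_def)
  have row: "cmod ((M *\<^sub>v v) $ i) \<le> (\<Sum>j<dim_col M. cmod (M $$ (i, j)))"
    if "i < dim_row M" for i
  proof -
    have "cmod ((M *\<^sub>v v) $ i) \<le> (\<Sum>j<dim_col M. cmod (M $$ (i, j)) * cmod (v $ j))"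
      using that v by (auto simp: scalar_prod_def atLeast0LessThan norm_mult intro!: sum_norm_le)
    also have "\<dots> \<le> (\<Sum>j<dim_col M. cmod (M $$ (i, j)))"
      by (intro sum_mono mult_left_le) (auto simp: vj)
    finally show ?thesis .
  qed
  have "vec_l2_norm (M *\<^sub>v v) \<le> (\<Sum>i<dim_row M. cmod ((M *\<^sub>v v) $ i))"
    using L2_set_le_sum[of "{..<dim_row M}" "\<lambda>i. cmod ((M *\<^sub>v v) $ i)"]
    by (simp add: vec_l2_norm_def)
  also have "\<dots> \<le> (\<Sum>i<dim_row M. \<Sum>j<dim_col M. cmod (M $$ (i, j)))"
    by (intro sum_mono row) auto
  finally show "vec_l2_norm (M *\<^sub>v v) \<le> (\<Sum>i<dim_row M. \<Sum>j<dim_col M. cmod (M $$ (i, j)))" .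
qed

lemma zero_in_unit_ball: "0\<^sub>v n \<in> {v \<in> carrier_vec n. vec_l2_norm v \<le> 1}"
  by (simp add: vec_l2_norm_def L2_set_def)

lemma mat_op_norm_nonneg: "0 \<le> mat_op_norm M"
  unfolding mat_op_norm_def
  by (rule cSUP_upper2[OF mat_op_norm_bdd_above zero_in_unit_ball]) simp

text \<open>For nonzero \<open>v\<close>, rescaling to length 1 puts it in the ball over which the
  supremum is taken; the zero vector has to be treated apart.\<close>

lemma vec_l2_norm_mult_mat_vec_le:
  assumes v: "v \<in> carrier_vec (dim_col M)"
  shows "vec_l2_norm (M *\<^sub>v v) \<le> mat_op_norm M * vec_l2_norm v"
proof (cases "vec_l2_norm v = 0")
  case True
  then have "v = 0\<^sub>v (dim_col M)"
    using v vec_l2_norm_eq_0D[of v] by (intro eq_vecI) auto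
  then show ?thesis using True by (simp add: vec_l2_norm_def L2_set_def)
next
  case False
  define r where "r = vec_l2_norm v"
  have r: "r > 0" using False vec_l2_norm_nonneg[of v] unfolding r_def by linarith
  define u where "u = complex_of_real (1 / r) \<cdot>\<^sub>v v"
  have u: "u \<in> carrier_vec (dim_col M)" using v by (simp add: u_def)
  have nu: "vec_l2_norm u = 1" using r by (simp add: u_def vec_l2_norm_smult norm_divide flip: r_def)
  have "vec_l2_norm (M *\<^sub>v u) \<le> mat_op_norm M"
    unfolding mat_op_norm_def
    by (rule cSUP_upper[OF _ mat_op_norm_bdd_above]) (use u nu in simp)
  moreover have "M *\<^sub>v u = complex_of_real (1 / r) \<cdot>\<^sub>v (M *\<^sub>v v)"
    using v by (simp add: u_def mult_mat_vec[of _ "dim_row M" "dim_col M"])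
  ultimately have "vec_l2_norm (M *\<^sub>v v) / r \<le> mat_op_norm M"
    using r by (simp add: vec_l2_norm_smult norm_divide)
  then show ?thesis using r by (simp add: r_def field_simps)
qed

lemma mat_op_norm_leI:
  assumes "\<And>v. v \<in> carrier_vec (dim_col M) \<Longrightarrow> vec_l2_norm (M *\<^sub>v v) \<le> c * vec_l2_norm v"
    and "0 \<le> c"
  shows "mat_op_norm M \<le> c"
  unfolding mat_op_norm_def
proof (rule cSUP_least)
  show "{v \<in> carrier_vec (dim_col M). vec_l2_norm v \<le> 1} \<noteq> {}"
    using zero_in_unit_ball by blast
next
  fix v assume "v \<in> {v \<in> carrier_vec (dim_col M). vec_l2_norm v \<le> 1}"
  then show "vec_l2_norm (M *\<^sub>v v) \<le> c"
    using assms mult_left_le[of "vec_l2_norm v" c] by force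
qed

lemma mat_op_norm_mult_le:
  fixes A B :: "complex mat"
  assumes "A \<in> carrier_mat n n" and "B \<in> carrier_mat n n"
  shows "mat_op_norm (A * B) \<le> mat_op_norm A * mat_op_norm B"
proof (rule mat_op_norm_leI)
  fix v :: "complex vec" assume "v \<in> carrier_vec (dim_col (A * B))"
  then have v: "v \<in> carrier_vec n" using assms by simp
  have Bv: "B *\<^sub>v v \<in> carrier_vec (dim_col A)" using assms v by simp
  have "vec_l2_norm (A * B *\<^sub>v v) = vec_l2_norm (A *\<^sub>v (B *\<^sub>v v))"
    using assms v by (simp add: assoc_mult_mat_vec[of _ n n _ n])
  also have "\<dots> \<le> mat_op_norm A * vec_l2_norm (B *\<^sub>v v)"
    by (rule vec_l2_norm_mult_mat_vec_le[OF Bv])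
  also have "\<dots> \<le> mat_op_norm A * (mat_op_norm B * vec_l2_norm v)"
    using assms v by (intro mult_left_mono vec_l2_norm_mult_mat_vec_le mat_op_norm_nonneg) simp
  finally show "vec_l2_norm (A * B *\<^sub>v v) \<le> mat_op_norm A * mat_op_norm B * vec_l2_norm v"
    by (simp add: mult.assoc)
qed (simp add: mat_op_norm_nonneg)

lemma mat_quadratic_form_le:
  assumes A: "A \<in> carrier_mat n n" and v: "v \<in> carrier_vec n"
  shows "cmod ((A *\<^sub>v v) \<bullet>c v) \<le> mat_op_norm A * (vec_l2_norm v)\<^sup>2"
proof -
  have "cmod ((A *\<^sub>v v) \<bullet>c v) \<le> vec_l2_norm (A *\<^sub>v v) * vec_l2_norm v"
    using A v by (intro vec_Cauchy_Schwarz) simp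
  also have "\<dots> \<le> (mat_op_norm A * vec_l2_norm v) * vec_l2_norm v"
    using A v by (intro mult_right_mono vec_l2_norm_mult_mat_vec_le) auto
  finally show ?thesis by (simp add: power2_eq_square mult.assoc)
qed

section \<open>Adjoints, and norm estimates obtained from \<open>X* X\<close>\<close>

lemma dim_mat_adjoint [simp]:
  "dim_row (mat_adjoint A) = dim_col A" "dim_col (mat_adjoint A) = dim_row A"
  by (simp_all add: mat_adjoint_def)

lemma mat_adjoint_carrier [simp]:
  "A \<in> carrier_mat n n \<Longrightarrow> mat_adjoint A \<in> carrier_mat n n"
  by (intro carrier_matI) simp_all

lemma index_mat_adjoint [simp]:
  assumes "i < dim_col A" and "j < dim_row A"
  shows "mat_adjoint A $$ (i, j) = cnj (A $$ (j, i))"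
  using assms by (simp add: mat_adjoint_def mat_of_rows_def)

lemma mat_adjoint_mult:
  fixes A B :: "complex mat"
  assumes "A \<in> carrier_mat n n" and "B \<in> carrier_mat n n"
  shows "mat_adjoint (A * B) = mat_adjoint B * mat_adjoint A"
  using assms by (intro eq_matI) (auto simp: scalar_prod_def mult.commute)

lemma cscalar_prod_mult_mat_vec:
  fixes A :: "complex mat"
  assumes "A \<in> carrier_mat n n" and "v \<in> carrier_vec n" and "w \<in> carrier_vec n"
  shows "(A *\<^sub>v v) \<bullet>c w = v \<bullet>c (mat_adjoint A *\<^sub>v w)"
proof -
  have "v \<bullet>c (mat_adjoint A *\<^sub>v w) = (\<Sum>j<n. \<Sum>i<n. v $ j * (A $$ (i, j) * cnj (w $ i)))"
    using assms by (simp add: scalar_prod_def sum_distrib_left atLeast0LessThan)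
  also have "\<dots> = (\<Sum>i<n. \<Sum>j<n. v $ j * (A $$ (i, j) * cnj (w $ i)))"
    by (rule sum.swap)
  also have "\<dots> = (A *\<^sub>v v) \<bullet>c w"
    using assms by (simp add: scalar_prod_def sum_distrib_left atLeast0LessThan mult_ac)
  finally show ?thesis ..
qed

text \<open>The square of the length of \<open>X v\<close> is the inner product of \<open>v\<close>
  with \<open>X* X v\<close>, hence at most \<open>(1 + s * mat_op_norm Z)\<close> times the square
  of the length of \<open>v\<close>. This turns an algebraic identity for \<open>X* X\<close> into
  the estimate that \<open>X\<close> has norm \<open>1 + O(s)\<close>.\<close>

lemma mat_op_norm_le_if_adjoint_mult_eq:
  assumes X: "X \<in> carrier_mat n n" and Z: "Z \<in> carrier_mat n n" and s: "0 \<le> s"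
    and eq: "mat_adjoint X * X = 1\<^sub>m n + complex_of_real s \<cdot>\<^sub>m Z"
  shows "mat_op_norm X \<le> 1 + s * mat_op_norm Z"
proof (rule mat_op_norm_leI)
  fix v :: "complex vec" assume "v \<in> carrier_vec (dim_col X)"
  then have v: "v \<in> carrier_vec n" using X by simp
  let ?c = "s * mat_op_norm Z"
  have c: "0 \<le> ?c" using s mat_op_norm_nonneg by simp
  have "complex_of_real ((vec_l2_norm (X *\<^sub>v v))\<^sup>2) = v \<bullet>c ((mat_adjoint X * X) *\<^sub>v v)"
    unfolding vec_l2_norm_square using X v mat_adjoint_carrier[OF X]
    by (simp add: cscalar_prod_mult_mat_vec[of X n v]
        assoc_mult_mat_vec[of _ n n _ n])
  also have "(mat_adjoint X * X) *\<^sub>v v = v + complex_of_real s \<cdot>\<^sub>v (Z *\<^sub>v v)"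
    using Z v by (auto simp: eq add_mult_distrib_mat_vec[of _ n n] intro!: eq_vecI)
  also have "v \<bullet>c (v + complex_of_real s \<cdot>\<^sub>v (Z *\<^sub>v v)) =
      complex_of_real ((vec_l2_norm v)\<^sup>2) + complex_of_real s * (v \<bullet>c (Z *\<^sub>v v))"
    unfolding vec_l2_norm_square using v Z
    by (simp add: scalar_prod_def sum_distrib_left algebra_simps sum.distrib)
  finally have "Re (complex_of_real ((vec_l2_norm (X *\<^sub>v v))\<^sup>2)) =
      Re (complex_of_real ((vec_l2_norm v)\<^sup>2) + complex_of_real s * (v \<bullet>c (Z *\<^sub>v v)))"
    by (rule arg_cong)
  then have "(vec_l2_norm (X *\<^sub>v v))\<^sup>2 = (vec_l2_norm v)\<^sup>2 + s * Re (v \<bullet>c (Z *\<^sub>v v))"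
    by (simp del: of_real_power)
  moreover have "Re (v \<bullet>c (Z *\<^sub>v v)) \<le> vec_l2_norm v * vec_l2_norm (Z *\<^sub>v v)"
    using vec_Cauchy_Schwarz[of v "Z *\<^sub>v v"] complex_Re_le_cmod[of "v \<bullet>c (Z *\<^sub>v v)"] v Z
    by simp
  moreover have "vec_l2_norm v * vec_l2_norm (Z *\<^sub>v v) \<le> vec_l2_norm v * (mat_op_norm Z * vec_l2_norm v)"
    using Z v by (intro mult_left_mono vec_l2_norm_mult_mat_vec_le) auto
  ultimately have "Re (v \<bullet>c (Z *\<^sub>v v)) \<le> vec_l2_norm v * (mat_op_norm Z * vec_l2_norm v)"
    and eq2: "(vec_l2_norm (X *\<^sub>v v))\<^sup>2 = (vec_l2_norm v)\<^sup>2 + s * Re (v \<bullet>c (Z *\<^sub>v v))"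
    by linarith+
  from mult_left_mono[OF this(1) s] have "(vec_l2_norm (X *\<^sub>v v))\<^sup>2
      \<le> (vec_l2_norm v)\<^sup>2 + s * (vec_l2_norm v * (mat_op_norm Z * vec_l2_norm v))"
    unfolding eq2 by simp
  also have "\<dots> = (1 + ?c) * (vec_l2_norm v)\<^sup>2"
    by (simp add: power2_eq_square algebra_simps)
  \<comment> \<open>Enlarging \<open>1 + ?c\<close> to its square avoids a square root in the bound
    and leaves the order in \<open>s\<close> unchanged.\<close>
  also have "\<dots> \<le> (1 + ?c)\<^sup>2 * (vec_l2_norm v)\<^sup>2"
    using c self_le_power[of "1 + ?c" 2] by (intro mult_right_mono) auto
  finally show "vec_l2_norm (X *\<^sub>v v) \<le> (1 + ?c) * vec_l2_norm v"
    using c by - (rule power2_le_imp_le, auto simp: power_mult_distrib)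
qed (use s mat_op_norm_nonneg in simp)

section \<open>Direct sums of matrix algebras\<close>

lemma matrix_sumD: "A \<in> matrix_sum d \<Longrightarrow> A k \<in> carrier_mat (d k) (d k)"
  by (simp add: matrix_sum_def)

lemma sum_one_closed [simp]: "sum_one d \<in> matrix_sum d"
  by (simp add: matrix_sum_def sum_one_def)

lemma sum_add_closed [simp]:
  "A \<in> matrix_sum d \<Longrightarrow> B \<in> matrix_sum d \<Longrightarrow> A + B \<in> matrix_sum d"
  by (simp add: matrix_sum_def)

lemma sum_mult_closed [simp]:
  "A \<in> matrix_sum d \<Longrightarrow> B \<in> matrix_sum d \<Longrightarrow> A * B \<in> matrix_sum d"
  by (auto simp: matrix_sum_def intro!: mult_carrier_mat)

lemma sum_smult_closed [simp]: "A \<in> matrix_sum d \<Longrightarrow> sum_smult c A \<in> matrix_sum d"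
  by (simp add: matrix_sum_def sum_smult_def)

lemma sum_adj_closed [simp]: "A \<in> matrix_sum d \<Longrightarrow> sum_adj A \<in> matrix_sum d"
  by (simp add: matrix_sum_def sum_adj_def)

lemma sum_mult_assoc:
  assumes "A \<in> matrix_sum d" and "B \<in> matrix_sum d" and "C \<in> matrix_sum d"
  shows "(A * B) * C = A * (B * C)"
  by (intro ext) (simp add: assoc_mult_mat[OF assms[THEN matrix_sumD]])

lemma sum_mult_add_distrib:
  assumes "A \<in> matrix_sum d" and "B \<in> matrix_sum d" and "C \<in> matrix_sum d"
  shows "A * (B + C) = A * B + A * C"
  by (intro ext) (simp add: mult_add_distrib_mat[OF assms[THEN matrix_sumD]])

lemma sum_add_mult_distrib:
  assumes "A \<in> matrix_sum d" and "B \<in> matrix_sum d" and "C \<in> matrix_sum d"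
  shows "(A + B) * C = A * C + B * C"
  by (intro ext) (simp add: add_mult_distrib_mat[OF assms[THEN matrix_sumD]])

lemma sum_smult_mult:
  assumes "A \<in> matrix_sum d" and "B \<in> matrix_sum d"
  shows "sum_smult c A * B = sum_smult c (A * B)"
  by (intro ext) (simp add: sum_smult_def mult_smult_assoc_mat[OF assms[THEN matrix_sumD]])

lemma sum_mult_smult:
  assumes "A \<in> matrix_sum d" and "B \<in> matrix_sum d"
  shows "A * sum_smult c B = sum_smult c (A * B)"
  by (intro ext) (simp add: sum_smult_def mult_smult_distrib[OF assms[THEN matrix_sumD]])

lemma sum_smult_smult: "sum_smult a (sum_smult b A) = sum_smult (a * b) A"
  by (auto simp: fun_eq_iff sum_smult_def)

lemma sum_mult_one [simp]: "A \<in> matrix_sum d \<Longrightarrow> A * sum_one d = A"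
  by (intro ext) (simp add: sum_one_def right_mult_one_mat[OF matrix_sumD])

lemma sum_one_mult [simp]: "A \<in> matrix_sum d \<Longrightarrow> sum_one d * A = A"
  by (intro ext) (simp add: sum_one_def left_mult_one_mat[OF matrix_sumD])

lemma sum_adj_adj [simp]: "sum_adj (sum_adj A) = A"
  by (auto simp: fun_eq_iff sum_adj_def intro!: eq_matI)

lemma sum_adj_add:
  assumes "A \<in> matrix_sum d" and "B \<in> matrix_sum d"
  shows "sum_adj (A + B) = sum_adj A + sum_adj B"
proof
  fix k
  show "sum_adj (A + B) k = (sum_adj A + sum_adj B) k"
    using assms[THEN matrix_sumD, of k] by (auto simp: sum_adj_def intro!: eq_matI)
qed

lemma sum_adj_smult: "sum_adj (sum_smult c A) = sum_smult (cnj c) (sum_adj A)"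
  by (auto simp: fun_eq_iff sum_adj_def sum_smult_def intro!: eq_matI)

lemma sum_adj_mult:
  assumes "A \<in> matrix_sum d" and "B \<in> matrix_sum d"
  shows "sum_adj (A * B) = sum_adj B * sum_adj A"
  by (intro ext) (simp add: sum_adj_def mat_adjoint_mult[OF assms[THEN matrix_sumD]])

lemma sum_adj_one [simp]: "sum_adj (sum_one d) = sum_one d"
  by (auto simp: fun_eq_iff sum_adj_def sum_one_def intro!: eq_matI)

lemma sum_eq_if_diff_zero:
  assumes "A \<in> matrix_sum d" and "B \<in> matrix_sum d" and "A + sum_smult (-1) B = sum_zero d"
  shows "A = B"
proof
  fix k
  have eq: "A k + (-1) \<cdot>\<^sub>m B k = 0\<^sub>m (d k) (d k)"
    using fun_cong[OF assms(3), of k] by (simp add: sum_smult_def sum_zero_def)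
  show "A k = B k"
  proof (rule eq_matI)
    fix i j assume "i < dim_row (B k)" "j < dim_col (B k)"
    then show "A k $$ (i, j) = B k $$ (i, j)"
      using assms(1,2)[THEN matrix_sumD, of k] arg_cong[OF eq, of "\<lambda>M. M $$ (i, j)"] by auto
  qed (use assms(1,2)[THEN matrix_sumD, of k] in auto)
qed

section \<open>The operator norm on the direct sum\<close>

lemma mat_op_norm_le_op_norm: "mat_op_norm (A k) \<le> op_norm A"
  by (simp add: op_norm_def)

lemma op_norm_nonneg: "0 \<le> op_norm A"
  using mat_op_norm_le_op_norm mat_op_norm_nonneg order_trans by blast

lemma op_norm_leI: "(\<And>k. mat_op_norm (A k) \<le> c) \<Longrightarrow> op_norm A \<le> c"
  by (auto simp: op_norm_def)

lemma op_norm_mult_le: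
  assumes "A \<in> matrix_sum d" and "B \<in> matrix_sum d"
  shows "op_norm (A * B) \<le> op_norm A * op_norm B"
proof (rule op_norm_leI)
  fix k
  have "mat_op_norm ((A * B) k) \<le> mat_op_norm (A k) * mat_op_norm (B k)"
    using assms[THEN matrix_sumD] by (auto intro!: mat_op_norm_mult_le)
  also have "\<dots> \<le> op_norm A * op_norm B"
    by (intro mult_mono mat_op_norm_le_op_norm mat_op_norm_nonneg op_norm_nonneg)
  finally show "mat_op_norm ((A * B) k) \<le> op_norm A * op_norm B" .
qed

lemma op_norm_le_if_adjoint_mult_eq:
  assumes X: "X \<in> matrix_sum d" and Z: "Z \<in> matrix_sum d" and s: "0 \<le> s"
    and eq: "sum_adj X * X = sum_one d + sum_smult (complex_of_real s) Z"
  shows "op_norm X \<le> 1 + s * op_norm Z"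
proof (rule op_norm_leI)
  fix k
  have "mat_op_norm (X k) \<le> 1 + s * mat_op_norm (Z k)"
    using fun_cong[OF eq, of k] X Z s
    by (intro mat_op_norm_le_if_adjoint_mult_eq[of _ "d k"] matrix_sumD)
       (simp_all add: sum_adj_def sum_one_def sum_smult_def)
  also have "\<dots> \<le> 1 + s * op_norm Z"
    using s by (intro add_left_mono mult_left_mono mat_op_norm_le_op_norm)
  finally show "mat_op_norm (X k) \<le> 1 + s * op_norm Z" .
qed

lemma op_norm_unitary_le:
  assumes "unitary_elem d U"
  shows "op_norm U \<le> 1"
proof -
  \<comment> \<open>A unitary is the case \<open>s = 0\<close> of the preceding estimate; any
    \<open>Z\<close> in the direct sum would do.\<close>
  have "sum_one d = sum_one d + sum_smult (complex_of_real 0) (sum_one d)"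
    by (auto simp: fun_eq_iff sum_one_def sum_smult_def intro!: eq_matI)
  then show ?thesis
    using op_norm_le_if_adjoint_mult_eq[of U d "sum_one d" 0] assms
    by (simp add: unitary_elem_def)
qed

text \<open>The terms \<open>i t H\<close> and \<open>- i t H\<close> cancel, so the deviation from
  the identity is only of second order in \<open>t\<close>.\<close>

lemma linear_curve_adjoint_mult:
  assumes H: "H \<in> matrix_sum d" and sa: "sum_adj H = H"
    and X: "X = sum_one d + sum_smult (\<i> * complex_of_real t) H"
  shows "sum_adj X * X = sum_one d + sum_smult (complex_of_real (t\<^sup>2)) (H * H)"
  using H carrier_matD[OF matrix_sumD[OF H]] unfolding X
  by (simp add: sum_adj_add[of _ d] sum_adj_smult sum_mult_add_distrib[of _ d]
        sum_add_mult_distrib[of _ d] sum_smult_mult[of _ d] sum_mult_smult[of _ d] sum_smult_smult sa)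
     (auto simp: fun_eq_iff sum_smult_def sum_one_def power2_eq_square algebra_simps
        simp del: index_mult_mat(1) intro!: eq_matI)

text \<open>\<open>X\<close> is the second Taylor polynomial of the unitary
  \<open>exp (i t H)\<close>. Here \<open>X* X\<close> is
  \<open>(1 - t^2 H^2 / 2)^2 + t^2 H^2\<close>, where the terms of second order cancel and only one
  of fourth order survives.\<close>

lemma quadratic_curve_adjoint_mult:
  assumes H: "H \<in> matrix_sum d" and sa: "sum_adj H = H"
    and X: "X = sum_one d +
      (sum_smult (\<i> * complex_of_real t) H + sum_smult (- complex_of_real (t\<^sup>2 / 2)) (H * H))"
  shows "sum_adj X * X = sum_one d + sum_smult (complex_of_real (t ^ 4 / 4)) (H * H * (H * H))"
  using H carrier_matD[OF matrix_sumD[OF H]] unfolding X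
  by (simp add: sum_adj_add[of _ d] sum_adj_smult sum_adj_mult[of _ d] sum_mult_add_distrib[of _ d]
        sum_add_mult_distrib[of _ d] sum_smult_mult[of _ d] sum_mult_smult[of _ d] sum_smult_smult
        sum_mult_assoc[of _ d] sa)
     (auto simp: fun_eq_iff sum_smult_def sum_one_def power2_eq_square power4_eq_xxxx algebra_simps
        simp del: index_mult_mat(1) intro!: eq_matI)
section \<open>Traces\<close>

text \<open>The matrix unit with row \<open>i\<close> and column \<open>j\<close> in the summand
  \<open>k\<close>, extended by zero to the other summands.\<close>

definition sum_unit :: "('n \<Rightarrow> nat) \<Rightarrow> 'n \<Rightarrow> nat \<Rightarrow> nat \<Rightarrow> 'n \<Rightarrow> complex mat" where
  "sum_unit d k i j =
     (\<lambda>l. mat (d l) (d l) (\<lambda>(a, b). if l = k \<and> a = i \<and> b = j then 1 else 0))"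

lemma sum_unit_closed [simp]: "sum_unit d k i j \<in> matrix_sum d"
  by (simp add: sum_unit_def matrix_sum_def)

lemma sum_unit_mult:
  assumes "j < d k"
  shows "sum_unit d k i j * sum_unit d k j' l = (if j = j' then sum_unit d k i l else sum_zero d)"
proof
  fix m
  \<comment> \<open>Both factors are indicators, so the sum over \<open>x\<close> has at most the
    one nonzero term \<open>x = j\<close>; this is the shape that \<open>sum.delta\<close>
    evaluates.\<close>
  have "(\<Sum>x = 0..<d m. (if m = k \<and> a = i \<and> x = j then 1 else 0) *
        (if m = k \<and> x = j' \<and> b = l then 1 else (0::complex))) =
      (\<Sum>x = 0..<d m. if x = j then (if m = k \<and> a = i \<and> j = j' \<and> b = l then 1 else 0) else 0)" for a b
    by (intro sum.cong) auto
  then show "(sum_unit d k i j * sum_unit d k j' l) m =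
      (if j = j' then sum_unit d k i l else sum_zero d) m"
    using assms
    by (auto simp: sum_unit_def sum_zero_def scalar_prod_def sum.delta intro!: eq_matI)
qed

lemma sum_adj_unit_diag [simp]: "sum_adj (sum_unit d k i i) = sum_unit d k i i"
  by (auto simp: fun_eq_iff sum_adj_def sum_unit_def intro!: eq_matI)

lemma sum_zero_closed [simp]: "sum_zero d \<in> matrix_sum d"
  by (simp add: matrix_sum_def sum_zero_def)

lemma sum_smult_zero:
  assumes "A \<in> matrix_sum d"
  shows "sum_smult 0 A = sum_zero d"
  using carrier_matD[OF matrix_sumD[OF assms]]
  by (auto simp: fun_eq_iff sum_smult_def sum_zero_def intro!: eq_matI)

text \<open>The diagonal entry is the quadratic form of \<open>A\<close> at the \<open>i\<close>-th
  column of \<open>W*\<close>. In this form Cauchy-Schwarz bounds it by the norm of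
  \<open>A\<close>.\<close>

lemma diag_conjugation:
  fixes A W :: "complex mat"
  assumes A: "A \<in> carrier_mat n n" and W: "W \<in> carrier_mat n n" and i: "i < n"
  shows "(W * A * mat_adjoint W) $$ (i, i) =
    (A *\<^sub>v col (mat_adjoint W) i) \<bullet>c col (mat_adjoint W) i"
proof -
  have aW: "mat_adjoint W \<in> carrier_mat n n" using W by simp
  have "conjugate (col (mat_adjoint W) i) = row W i"
    using carrier_matD[OF W] i by (intro eq_vecI) simp_all
  moreover have "(W * A * mat_adjoint W) $$ (i, i) = (W * (A * mat_adjoint W)) $$ (i, i)"
    using A W aW by (simp add: assoc_mult_mat[of _ n n _ n _ n])
  moreover have "\<dots> = row W i \<bullet> (A *\<^sub>v col (mat_adjoint W) i)"
    using A W aW i by (simp add: col_mult2[OF A aW])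
  ultimately show ?thesis
    using A W aW i by (metis comm_scalar_prod mult_mat_vec_carrier col_carrier_vec carrier_matD row_carrier_vec)
qed

locale faithful_trace =
  fixes d :: "'n::finite \<Rightarrow> nat" and \<tau> :: "('n \<Rightarrow> complex mat) \<Rightarrow> complex"
  assumes linear: "linear_functional d \<tau>"
    and positive: "A \<in> matrix_sum d \<Longrightarrow> 0 \<le> \<tau> (sum_adj A * A)"
    and faithful: "faithful d \<tau>"
    and tracial: "tracial d \<tau>"
begin

lemma trace_add [simp]: "A \<in> matrix_sum d \<Longrightarrow> B \<in> matrix_sum d \<Longrightarrow> \<tau> (A + B) = \<tau> A + \<tau> B"
  using linear by (simp add: linear_functional_def)

lemma trace_smult [simp]: "A \<in> matrix_sum d \<Longrightarrow> \<tau> (sum_smult c A) = c * \<tau> A"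
  using linear by (simp add: linear_functional_def)

lemma trace_commute: "A \<in> matrix_sum d \<Longrightarrow> B \<in> matrix_sum d \<Longrightarrow> \<tau> (A * B) = \<tau> (B * A)"
  using tracial by (simp add: tracial_def)

lemma trace_zero [simp]: "\<tau> (sum_zero d) = 0"
  using trace_smult[of "sum_zero d" 0] sum_smult_zero[of "sum_zero d" d] by simp

lemma trace_eq_0D: "A \<in> matrix_sum d \<Longrightarrow> \<tau> (sum_adj A * A) = 0 \<Longrightarrow> A = sum_zero d"
  using faithful by (simp add: faithful_def)

text \<open>With \<open>E_ij\<close> the matrix units, \<open>E_ij = E_ii E_ij\<close>, whereas the
  product in the other order, \<open>E_ij E_ii\<close>, vanishes for distinct \<open>i\<close> and
  \<open>j\<close>.\<close>

lemma trace_unit_off_diag: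
  assumes "i < d k" and "j < d k" and "i \<noteq> j"
  shows "\<tau> (sum_unit d k i j) = 0"
proof -
  have "\<tau> (sum_unit d k i j) = \<tau> (sum_unit d k i i * sum_unit d k i j)"
    using assms by (simp add: sum_unit_mult)
  also have "\<dots> = \<tau> (sum_unit d k i j * sum_unit d k i i)"
    by (rule trace_commute) auto
  also have "\<dots> = 0"
    using assms by (simp add: sum_unit_mult)
  finally show ?thesis .
qed

definition weight :: "'n \<Rightarrow> nat \<Rightarrow> real" where
  "weight k i = Re (\<tau> (sum_unit d k i i))"

lemma trace_unit_nonneg: "i < d k \<Longrightarrow> 0 \<le> \<tau> (sum_unit d k i i)"
  using positive[of "sum_unit d k i i"] by (simp add: sum_unit_mult)

lemma weight_nonneg: "i < d k \<Longrightarrow> 0 \<le> weight k i"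
  using trace_unit_nonneg by (simp add: weight_def less_eq_complex_def)

lemma trace_unit_diag: "i < d k \<Longrightarrow> \<tau> (sum_unit d k i i) = complex_of_real (weight k i)"
  using trace_unit_nonneg by (simp add: weight_def less_eq_complex_def complex_eq_iff)

text \<open>Linearity is given for two summands only. The expansion in matrix units is therefore
  built up by induction, letting one more entry of \<open>A\<close> be nonzero at each step.\<close>

lemma trace_restrict:
  assumes "finite S" and "S \<subseteq> (SIGMA k:UNIV. {..<d k} \<times> {..<d k})"
  shows "\<tau> (\<lambda>k. mat (d k) (d k) (\<lambda>(i, j). if (k, i, j) \<in> S then A k $$ (i, j) else 0)) =
    (\<Sum>(k, i, j)\<in>S. A k $$ (i, j) * \<tau> (sum_unit d k i j))"
  using assms
proof (induction S rule: finite_induct)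
  case empty
  have "(\<lambda>k. mat (d k) (d k) (\<lambda>(i, j). 0)) = sum_zero d"
    by (auto simp: fun_eq_iff sum_zero_def intro!: eq_matI)
  then show ?case using trace_zero by (simp add: case_prod_unfold)
next
  case (insert x S)
  obtain l a b where x: "x = (l, a, b)" by (cases x) auto
  let ?R = "\<lambda>S k. mat (d k) (d k) (\<lambda>(i, j). if (k, i, j) \<in> S then A k $$ (i, j) else 0)"
  have eq: "?R (insert x S) = sum_smult (A l $$ (a, b)) (sum_unit d l a b) + ?R S"
    using insert.hyps x
    by (auto simp: fun_eq_iff sum_smult_def sum_unit_def intro!: eq_matI)
  have "?R S \<in> matrix_sum d" by (simp add: matrix_sum_def)
  then have "\<tau> (?R (insert x S)) = A l $$ (a, b) * \<tau> (sum_unit d l a b) + \<tau> (?R S)"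
    unfolding eq by (subst trace_add) auto
  also have "\<tau> (?R S) = (\<Sum>(k, i, j)\<in>S. A k $$ (i, j) * \<tau> (sum_unit d k i j))"
    by (rule insert.IH) (use insert.prems in auto)
  finally show ?case using insert.hyps x by simp
qed

lemma trace_eq_weighted_diag:
  assumes "A \<in> matrix_sum d"
  shows "\<tau> A = (\<Sum>k\<in>UNIV. \<Sum>i<d k. complex_of_real (weight k i) * A k $$ (i, i))"
proof -
  let ?I = "SIGMA k:UNIV. {..<d k} \<times> {..<d k}"
  have "A = (\<lambda>k. mat (d k) (d k) (\<lambda>(i, j). if (k, i, j) \<in> ?I then A k $$ (i, j) else 0))"
    using carrier_matD[OF matrix_sumD[OF assms]] by (auto simp: fun_eq_iff intro!: eq_matI)
  then have "\<tau> A = (\<Sum>(k, i, j)\<in>?I. A k $$ (i, j) * \<tau> (sum_unit d k i j))"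
    using trace_restrict[of ?I A] by simp
  also have "\<dots> = (\<Sum>k\<in>UNIV. \<Sum>i<d k. \<Sum>j<d k. A k $$ (i, j) * \<tau> (sum_unit d k i j))"
    by (simp add: sum.Sigma sum.cartesian_product case_prod_unfold)
  also have "\<dots> = (\<Sum>k\<in>UNIV. \<Sum>i<d k. \<Sum>j<d k. if j = i then complex_of_real (weight k i) * A k $$ (i, i) else 0)"
    by (intro sum.cong) (auto simp: trace_unit_off_diag trace_unit_diag)
  also have "\<dots> = (\<Sum>k\<in>UNIV. \<Sum>i<d k. complex_of_real (weight k i) * A k $$ (i, i))"
    by (simp add: sum.delta)
  finally show ?thesis .
qed

text \<open>The adjoint conjugates the diagonal entries, and the weights are real.\<close>

lemma trace_adj:
  assumes "A \<in> matrix_sum d"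
  shows "\<tau> (sum_adj A) = cnj (\<tau> A)"
proof -
  have "sum_adj A k $$ (i, i) = cnj (A k $$ (i, i))" if "i < d k" for k i
    using carrier_matD[OF matrix_sumD[OF assms]] that by (simp add: sum_adj_def)
  then show ?thesis
    by (simp add: trace_eq_weighted_diag assms)
qed

text \<open>Diagonal entries of \<open>W A W*\<close> are values of the quadratic form of
  \<open>A\<close> at the columns of \<open>W*\<close>, and the squared lengths of these columns are
  the diagonal entries of \<open>W W*\<close>. Nonnegative weights allow the entrywise bounds to be
  summed.\<close>

lemma cmod_trace_conjugation_le:
  assumes A: "A \<in> matrix_sum d" and W: "W \<in> matrix_sum d"
  shows "cmod (\<tau> (W * A * sum_adj W)) \<le> op_norm A * Re (\<tau> (W * sum_adj W))"
proof -
  let ?w = "\<lambda>k i. col (mat_adjoint (W k)) i"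
  have Ak: "A k \<in> carrier_mat (d k) (d k)" and Wk: "W k \<in> carrier_mat (d k) (d k)" for k
    using A W by (auto dest: matrix_sumD)
  have wc: "?w k i \<in> carrier_vec (d k)" if "i < d k" for k i
    using mat_adjoint_carrier[OF Wk[of k]] that by (metis carrier_matD(1) carrier_vecI dim_col)
  have WA: "W * A * sum_adj W \<in> matrix_sum d" and WW: "W * sum_adj W \<in> matrix_sum d"
    using A W by auto
  have diag: "(W * sum_adj W) k $$ (i, i) = complex_of_real ((vec_l2_norm (?w k i))\<^sup>2)"
    if "i < d k" for k i
  proof -
    have "(W * sum_adj W) k $$ (i, i) = (W k * 1\<^sub>m (d k) * mat_adjoint (W k)) $$ (i, i)"
      using Wk[of k] by (simp add: sum_adj_def)
    also have "\<dots> = (1\<^sub>m (d k) *\<^sub>v ?w k i) \<bullet>c ?w k i"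
      using that Wk by (intro diag_conjugation) auto
    finally show ?thesis
      using wc[OF that] by (simp only: vec_l2_norm_square one_mult_mat_vec)
  qed
  have entry: "cmod ((W * A * sum_adj W) k $$ (i, i)) \<le> op_norm A * (vec_l2_norm (?w k i))\<^sup>2"
    if "i < d k" for k i
  proof -
    have "cmod ((W * A * sum_adj W) k $$ (i, i)) \<le> mat_op_norm (A k) * (vec_l2_norm (?w k i))\<^sup>2"
      using mat_quadratic_form_le[OF Ak wc[OF that]] diag_conjugation[OF Ak Wk that]
      by (simp add: sum_adj_def)
    also have "\<dots> \<le> op_norm A * (vec_l2_norm (?w k i))\<^sup>2"
      by (intro mult_right_mono mat_op_norm_le_op_norm) simp
    finally show ?thesis .
  qed
  have "cmod (\<tau> (W * A * sum_adj W)) \<le> (\<Sum>k\<in>UNIV. \<Sum>i<d k. weight k i * (op_norm A * (vec_l2_norm (?w k i))\<^sup>2))"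
    unfolding trace_eq_weighted_diag[OF WA]
    using entry by (intro sum_norm_le) (simp add: norm_mult weight_nonneg mult_left_mono)
  also have "\<dots> = op_norm A * Re (\<tau> (W * sum_adj W))"
    unfolding trace_eq_weighted_diag[OF WW]
    using diag by (simp add: sum_distrib_left mult_ac)
  finally show ?thesis .
qed

lemma cmod_trace_le: "A \<in> matrix_sum d \<Longrightarrow> cmod (\<tau> A) \<le> op_norm A * Re (\<tau> (sum_one d))"
  using cmod_trace_conjugation_le[of A "sum_one d"] by simp

end

section \<open>Uniqueness of the conditional expectation\<close>

lemma eq_zero_if_linear_le_quadratic:
  fixes y k :: real
  assumes "\<And>t. t * y \<le> t\<^sup>2 * k"
  shows "y = 0"
proof (rule ccontr)
  assume y: "y \<noteq> 0"
  \<comment> \<open>This makes \<open>t * y\<close> equal to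
    \<open>t\<^sup>2 * (1 + \<bar>k\<bar>)\<close>, which exceeds the assumed bound.\<close>
  define t where "t = y / (1 + \<bar>k\<bar>)"
  have t: "t \<noteq> 0" using y by (simp add: t_def add_nonneg_eq_0_iff)
  have "t\<^sup>2 * k < t\<^sup>2 * (1 + \<bar>k\<bar>)"
    using t by (intro mult_strict_left_mono) auto
  also have "\<dots> = t * y" by (simp add: t_def power2_eq_square)
  finally show False using assms[of t] by simp
qed

text \<open>Both sides agree up to first order in \<open>t\<close>, and only the left one has a term
  of second order. Dividing by \<open>t\<^sup>2\<close> and letting \<open>t\<close> tend to 0 gives
  the claim.\<close>

lemma quadratic_coeff_nonpos:
  fixes \<alpha> \<beta> \<gamma> q a b :: real
  assumes le: "\<And>t. 0 < t \<Longrightarrow> t \<le> 1 \<Longrightarrow>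
      q + t\<^sup>2 * \<alpha> + t ^ 3 * \<beta> + t ^ 4 * \<gamma> \<le> (1 + t ^ 4 * a) * (1 + t ^ 4 * b) * q"
    and nonneg: "0 \<le> q" "0 \<le> a" "0 \<le> b"
  shows "\<alpha> \<le> 0"
proof (rule ccontr)
  assume \<alpha>: "\<not> \<alpha> \<le> 0"
  \<comment> \<open>For \<open>t\<close> in (0,1] the powers \<open>t ^ 4\<close> and
    \<open>t ^ 8\<close> are at most \<open>t ^ 3\<close>, so \<open>K\<close> can collect all terms
    of order at least 3.\<close>
  define K where "K = \<bar>\<beta>\<bar> + \<bar>\<gamma>\<bar> + (a + b + a * b) * q"
  have K: "0 \<le> K" using nonneg by (simp add: K_def)
  have bound: "\<alpha> \<le> t * K" if t: "0 < t" "t \<le> 1" for t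
  proof -
    have t4: "t ^ 4 \<le> t ^ 3" "t ^ 8 \<le> t ^ 3"
      using t by (auto intro: power_decreasing)
    have "t ^ 4 * (a * q) \<le> t ^ 3 * (a * q)" "t ^ 4 * (b * q) \<le> t ^ 3 * (b * q)"
      "t ^ 8 * (a * b * q) \<le> t ^ 3 * (a * b * q)"
      using t4 nonneg by (auto intro!: mult_right_mono)
    moreover have "- (t ^ 3 * \<beta>) \<le> t ^ 3 * \<bar>\<beta>\<bar>"
      using t by (simp flip: mult_minus_right)
    moreover have "- (t ^ 4 * \<gamma>) \<le> t ^ 3 * \<bar>\<gamma>\<bar>"
    proof -
      have "- (t ^ 4 * \<gamma>) \<le> t ^ 4 * \<bar>\<gamma>\<bar>" using t by (simp flip: mult_minus_right)
      also have "\<dots> \<le> t ^ 3 * \<bar>\<gamma>\<bar>" using t4 by (intro mult_right_mono) auto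
      finally show ?thesis .
    qed
    moreover have "(1 + t ^ 4 * a) * (1 + t ^ 4 * b) * q =
        q + t ^ 4 * (a * q) + t ^ 4 * (b * q) + t ^ 8 * (a * b * q)"
      by (simp add: algebra_simps flip: power_add)
    ultimately have "t\<^sup>2 * \<alpha> \<le> t ^ 3 * \<bar>\<beta>\<bar> + t ^ 3 * \<bar>\<gamma>\<bar> + t ^ 3 * (a * q) + t ^ 3 * (b * q) + t ^ 3 * (a * b * q)"
      using le[OF t] by linarith
    also have "\<dots> = t\<^sup>2 * (t * K)"
      by (simp add: K_def algebra_simps power2_eq_square power3_eq_cube)
    finally show ?thesis using t by simp
  qed
  \<comment> \<open>Small enough that \<open>t * K\<close> is at most half of
    \<open>\<alpha>\<close>; the summand 1 keeps the denominator positive.\<close>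
  define t where "t = min 1 (\<alpha> / (2 * (K + 1)))"
  have "0 < t" "t \<le> 1" using \<alpha> K by (auto simp: t_def)
  then have "\<alpha> \<le> t * K" by (rule bound)
  also have "\<dots> \<le> \<alpha> / (2 * (K + 1)) * (K + 1)"
    using K \<alpha> by (intro mult_mono) (auto simp: t_def)
  also have "\<dots> = \<alpha> / 2" using K by (simp add: field_simps)
  finally show False using \<alpha> by simp
qed

text \<open>The real and imaginary parts of an element reduce an equality of two linear maps to
  self-adjoint arguments.\<close>

lemma sum_cartesian_decomposition:
  assumes "A \<in> matrix_sum d"
  obtains R S where "R \<in> matrix_sum d" "S \<in> matrix_sum d" "sum_adj R = R" "sum_adj S = S"
    "A = R + sum_smult \<i> S"
proof
  let ?R = "sum_smult (1 / 2) (A + sum_adj A)"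
  let ?S = "sum_smult (\<i> / 2) (sum_adj A + sum_smult (-1) A)"
  note [simp] = carrier_matD[OF matrix_sumD[OF assms]]
  show "?R \<in> matrix_sum d" "?S \<in> matrix_sum d"
    using assms by auto
  show "sum_adj ?R = ?R" "sum_adj ?S = ?S" "A = ?R + sum_smult \<i> ?S"
    by (auto simp: fun_eq_iff sum_smult_def sum_adj_def algebra_simps intro!: eq_matI)
qed

section \<open>Trace-preserving expectations: self-adjointness, orthogonality and uniqueness\<close>

context faithful_trace
begin

text \<open>The predicate under \<open>THE\<close> in \<open>cond_exp\<close>, named so that its
  uniqueness and its behaviour under conjugation can be stated.\<close>

definition trace_expectation ::
  "('n \<Rightarrow> complex mat) set \<Rightarrow> (('n \<Rightarrow> complex mat) \<Rightarrow> 'n \<Rightarrow> complex mat) \<Rightarrow> bool" where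
  "trace_expectation D P \<longleftrightarrow>
     conditional_expectation d D P \<and> (\<forall>A\<in>matrix_sum d. \<tau> (P A) = \<tau> A)"

lemma Im_trace_sa:
  assumes "A \<in> matrix_sum d" and "sum_adj A = A"
  shows "Im (\<tau> A) = 0"
  using trace_adj[OF assms(1)] assms(2) by (simp add: complex_eq_iff)

lemma trace_one_nonneg: "0 \<le> Re (\<tau> (sum_one d))"
  using positive[of "sum_one d"] by (simp add: less_eq_complex_def)

context
  fixes D P
  assumes D: "unital_cstar_subalgebra d D" and P: "trace_expectation D P"
begin

lemma expectation_mem: "A \<in> matrix_sum d \<Longrightarrow> P A \<in> D"
  using P by (auto simp: trace_expectation_def conditional_expectation_def)

lemma subalgebra_mem: "A \<in> D \<Longrightarrow> A \<in> matrix_sum d"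
  using D by (auto simp: unital_cstar_subalgebra_def)

lemma expectation_closed [simp]: "A \<in> matrix_sum d \<Longrightarrow> P A \<in> matrix_sum d"
  by (simp add: expectation_mem subalgebra_mem)

lemma expectation_add [simp]:
  "A \<in> matrix_sum d \<Longrightarrow> B \<in> matrix_sum d \<Longrightarrow> P (A + B) = P A + P B"
  using P by (simp add: trace_expectation_def conditional_expectation_def)

lemma expectation_smult [simp]: "A \<in> matrix_sum d \<Longrightarrow> P (sum_smult c A) = sum_smult c (P A)"
  using P by (simp add: trace_expectation_def conditional_expectation_def)

lemma expectation_id: "A \<in> D \<Longrightarrow> P A = A"
  using P by (simp add: trace_expectation_def conditional_expectation_def)

lemma expectation_one [simp]: "P (sum_one d) = sum_one d"
  using D by (simp add: expectation_id unital_cstar_subalgebra_def)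

lemma expectation_norm_le: "A \<in> matrix_sum d \<Longrightarrow> op_norm (P A) \<le> op_norm A"
  using P by (simp add: trace_expectation_def conditional_expectation_def)

lemma trace_expectation_eq [simp]: "A \<in> matrix_sum d \<Longrightarrow> \<tau> (P A) = \<tau> A"
  using P by (simp add: trace_expectation_def)

text \<open>The real part of the trace of \<open>W P(1 + i t H) W*\<close> contains
  \<open>- t\<close> times this imaginary part, while the norm bound lets it exceed its value at
  \<open>t = 0\<close> only by a multiple of \<open>t\<^sup>2\<close>. The freedom in
  \<open>W\<close> is used below for polarization.\<close>

lemma Im_trace_conjugated_expectation:
  assumes H: "H \<in> matrix_sum d" "sum_adj H = H" and W: "W \<in> matrix_sum d"
  shows "Im (\<tau> (W * P H * sum_adj W)) = 0"
proof -
  let ?q = "Re (\<tau> (W * sum_adj W))"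
  have q: "0 \<le> ?q"
    using positive[of "sum_adj W"] W by (simp add: less_eq_complex_def)
  have "t * - Im (\<tau> (W * P H * sum_adj W)) \<le> t\<^sup>2 * (op_norm (H * H) * ?q)" for t
  proof -
    define X where "X = sum_one d + sum_smult (\<i> * complex_of_real t) H"
    have X: "X \<in> matrix_sum d" using H by (simp add: X_def)
    have "op_norm X \<le> 1 + t\<^sup>2 * op_norm (H * H)"
      using H X by (intro op_norm_le_if_adjoint_mult_eq linear_curve_adjoint_mult) (auto simp: X_def)
    then have nX: "op_norm (P X) \<le> 1 + t\<^sup>2 * op_norm (H * H)"
      using expectation_norm_le[OF X] by simp
    have "\<tau> (W * P X * sum_adj W) =
        \<tau> (W * sum_adj W) + \<i> * complex_of_real t * \<tau> (W * P H * sum_adj W)"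
      using H W by (simp add: X_def sum_mult_add_distrib[of _ d] sum_add_mult_distrib[of _ d]
          sum_smult_mult[of _ d] sum_mult_smult[of _ d])
    then have "?q - t * Im (\<tau> (W * P H * sum_adj W)) \<le> cmod (\<tau> (W * P X * sum_adj W))"
      using complex_Re_le_cmod[of "\<tau> (W * P X * sum_adj W)"] by simp
    also have "\<dots> \<le> op_norm (P X) * ?q"
      using X W by (intro cmod_trace_conjugation_le) auto
    also have "\<dots> \<le> (1 + t\<^sup>2 * op_norm (H * H)) * ?q"
      using nX q by (rule mult_right_mono)
    finally show ?thesis by (simp add: algebra_simps)
  qed
  from eq_zero_if_linear_le_quadratic[OF this] show ?thesis by simp
qed

text \<open>The difference \<open>T\<close> of \<open>P H\<close> and its adjoint is skew-adjoint,
  and the trace of \<open>W T W*\<close> vanishes for every \<open>W\<close>. Polarization with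
  \<open>W = 1 + i T\<close> and \<open>W = 1 - i T\<close> gives \<open>\<tau> (T * T) = 0\<close>,
  and faithfulness finishes.\<close>

lemma expectation_sa:
  assumes H: "H \<in> matrix_sum d" "sum_adj H = H"
  shows "sum_adj (P H) = P H"
proof -
  define T where "T = P H + sum_smult (-1) (sum_adj (P H))"
  have T: "T \<in> matrix_sum d" using H by (simp add: T_def)
  have adjT: "sum_adj T = sum_smult (-1) T"
    using H carrier_matD[OF matrix_sumD[OF expectation_closed[OF H(1)]]]
    by (auto simp: fun_eq_iff T_def sum_adj_def sum_smult_def intro!: eq_matI)
  have zero: "\<tau> (W * T * sum_adj W) = 0" if W: "W \<in> matrix_sum d" for W
  proof -
    have "\<tau> (W * sum_adj (P H) * sum_adj W) = cnj (\<tau> (W * P H * sum_adj W))"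
      using H W by (subst trace_adj[symmetric]) (auto simp: sum_adj_mult[of _ d] sum_mult_assoc[of _ d])
    then show ?thesis
      using Im_trace_conjugated_expectation[OF H W] H W
      by (simp add: T_def sum_mult_add_distrib[of _ d] sum_add_mult_distrib[of _ d]
          sum_smult_mult[of _ d] sum_mult_smult[of _ d] complex_eq_iff)
  qed
  have "\<tau> ((sum_one d + sum_smult c T) * T * sum_adj (sum_one d + sum_smult c T)) =
      \<tau> T + (c - cnj c) * \<tau> (T * T) - c * cnj c * \<tau> (T * T * T)" for c
    using T by (simp add: sum_adj_add[of _ d] sum_adj_smult adjT sum_mult_add_distrib[of _ d]
        sum_add_mult_distrib[of _ d] sum_smult_mult[of _ d] sum_mult_smult[of _ d] sum_smult_smult
        algebra_simps)
  \<comment> \<open>Both left sides vanish. Subtracting them removes the first and the third power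
    of \<open>T\<close> and leaves \<open>4 * \<i> * \<tau> (T * T)\<close>.\<close>
  from this[of \<i>] this[of "-\<i>"] have "\<tau> (T * T) = 0"
    using zero T by (simp add: algebra_simps)
  then have "\<tau> (sum_adj T * T) = 0"
    using T by (simp add: adjT sum_smult_mult[of _ d])
  then have "T = sum_zero d" using T by (intro trace_eq_0D)
  then show ?thesis
    using H unfolding T_def by (metis sum_eq_if_diff_zero expectation_closed sum_adj_closed)
qed

lemma Re_trace_mult_expectation_le:
  assumes H: "H \<in> matrix_sum d" "sum_adj H = H" and G: "G \<in> matrix_sum d" "sum_adj G = G"
  shows "Re (\<tau> (G * P H)) \<le> (Re (\<tau> (H * H)) + Re (\<tau> (G * G))) / 2"
proof -
  define curve where "curve t X = sum_one d +
    (sum_smult (\<i> * complex_of_real t) X + sum_smult (- complex_of_real (t\<^sup>2 / 2)) (X * X))" for t X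
  have curve_closed [simp]: "curve t X \<in> matrix_sum d" if "X \<in> matrix_sum d" for t X
    using that by (simp add: curve_def)
  have curve_norm: "op_norm (curve t X) \<le> 1 + t ^ 4 * (op_norm (X * X * (X * X)) / 4)"
    if "X \<in> matrix_sum d" "sum_adj X = X" for t X
    using op_norm_le_if_adjoint_mult_eq[OF _ _ _ quadratic_curve_adjoint_mult[OF that curve_def]] that
    by simp
  let ?q = "Re (\<tau> (sum_one d))"
  let ?\<alpha> = "Re (\<tau> (G * P H)) - (Re (\<tau> (H * H)) + Re (\<tau> (G * G))) / 2"
  \<comment> \<open>\<open>?\<alpha>\<close>, \<open>?\<beta>\<close> and \<open>?\<gamma>\<close>
    are the coefficients of the second, third and fourth power of \<open>t\<close> in the real part
    of the trace of \<open>curve (- t) G * P (curve t H)\<close>.\<close>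
  let ?\<beta> = "(Im (\<tau> (G * G * P H)) - Im (\<tau> (G * P (H * H)))) / 2"
  let ?\<gamma> = "Re (\<tau> (G * G * P (H * H))) / 4"
  let ?a = "op_norm (G * G * (G * G)) / 4" and ?b = "op_norm (H * H * (H * H)) / 4"
  have "?q + t\<^sup>2 * ?\<alpha> + t ^ 3 * ?\<beta> + t ^ 4 * ?\<gamma> \<le> (1 + t ^ 4 * ?a) * (1 + t ^ 4 * ?b) * ?q" for t
  proof -
    \<comment> \<open>There is no term of first order: its coefficient is
      \<open>\<i> * (\<tau> H - \<tau> G)\<close>, and self-adjoint elements have real trace.
      Preservation of the trace replaces \<open>\<tau> (P (H * H))\<close> by
      \<open>\<tau> (H * H)\<close>.\<close>
    have "Re (\<tau> (curve (- t) G * P (curve t H))) = ?q + t\<^sup>2 * ?\<alpha> + t ^ 3 * ?\<beta> + t ^ 4 * ?\<gamma>"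
      using H G Im_trace_sa[OF H] Im_trace_sa[OF G]
      by (simp add: curve_def sum_mult_add_distrib[of _ d]
        sum_add_mult_distrib[of _ d] sum_smult_mult[of _ d] sum_mult_smult[of _ d] sum_smult_smult
        algebra_simps power2_eq_square power3_eq_cube power4_eq_xxxx add_divide_distrib diff_divide_distrib)
    then have "?q + t\<^sup>2 * ?\<alpha> + t ^ 3 * ?\<beta> + t ^ 4 * ?\<gamma> \<le> cmod (\<tau> (curve (- t) G * P (curve t H)))"
      using complex_Re_le_cmod by metis
    also have "\<dots> \<le> op_norm (curve (- t) G * P (curve t H)) * ?q"
      using H G by (intro cmod_trace_le) simp
    also have "\<dots> \<le> op_norm (curve (- t) G) * op_norm (P (curve t H)) * ?q"
      using H G by (intro mult_right_mono op_norm_mult_le[of _ d] trace_one_nonneg) auto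
    also have "\<dots> \<le> (1 + t ^ 4 * ?a) * (1 + t ^ 4 * ?b) * ?q"
      using curve_norm[OF G, of "- t"] curve_norm[OF H, of t]
        expectation_norm_le[OF curve_closed[OF H(1)], of t]
      by (intro mult_right_mono mult_mono op_norm_nonneg trace_one_nonneg)
         (auto simp: op_norm_nonneg)
    finally show ?thesis .
  qed
  then have "?\<alpha> \<le> 0"
    by (rule quadratic_coeff_nonpos) (auto simp: op_norm_nonneg trace_one_nonneg)
  then show ?thesis by simp
qed

text \<open>Since \<open>P E = E\<close>, the inequality for \<open>H + s E\<close> and
  \<open>s E\<close> has \<open>s^2 * Re (\<tau> (E * E))\<close> on both sides. After cancellation,
  \<open>s\<close> times the difference of the two traces stays below a constant for all real
  \<open>s\<close>, which forces the difference to vanish.\<close>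

lemma Re_trace_mult_expectation_eq:
  assumes H: "H \<in> matrix_sum d" "sum_adj H = H" and E: "E \<in> D" "sum_adj E = E"
  shows "Re (\<tau> (E * P H)) = Re (\<tau> (E * H))"
proof -
  have E': "E \<in> matrix_sum d" using E subalgebra_mem by simp
  have comm: "\<tau> (H * E) = \<tau> (E * H)" using H E' by (intro trace_commute)
  have "s * (Re (\<tau> (E * P H)) - Re (\<tau> (E * H))) \<le> Re (\<tau> (H * H)) / 2" for s
  proof -
    let ?E = "sum_smult (complex_of_real s) E"
    have "Re (\<tau> (?E * P (H + ?E))) \<le>
        (Re (\<tau> ((H + ?E) * (H + ?E))) + Re (\<tau> (?E * ?E))) / 2"
      using H E E' by (intro Re_trace_mult_expectation_le)
        (auto simp: sum_adj_add[of _ d] sum_adj_smult)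
    then show ?thesis
      using H E E' expectation_id[OF E(1)] comm
      by (simp add: sum_mult_add_distrib[of _ d] sum_add_mult_distrib[of _ d]
          sum_smult_mult[of _ d] sum_mult_smult[of _ d] sum_smult_smult field_simps)
  qed
  note le = this
  let ?x = "Re (\<tau> (E * P H)) - Re (\<tau> (E * H))" and ?k = "Re (\<tau> (H * H)) / 2"
  have "?x = 0"
  proof (rule ccontr)
    assume "?x \<noteq> 0"
    \<comment> \<open>With this \<open>s\<close> the left side is \<open>?k + 1\<close>, above the
      bound \<open>?k\<close>.\<close>
    then show False using le[of "(?k + 1) / ?x"] by simp
  qed
  then show ?thesis by simp
qed

end

text \<open>For self-adjoint \<open>H\<close> the difference \<open>T\<close> of the two images is a
  self-adjoint element of \<open>D\<close>, so it may serve as the test element \<open>E\<close> for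
  both expectations. This gives \<open>Re (\<tau> (T * T)) = 0\<close>, and faithfulness yields
  \<open>T = 0\<close>.\<close>

lemma trace_expectation_unique:
  assumes D: "unital_cstar_subalgebra d D"
    and P: "trace_expectation D P" and Q: "trace_expectation D Q"
  shows "P = Q"
proof -
  note PQ [simp] = expectation_closed[OF D P] expectation_closed[OF D Q]
  have sa: "P H = Q H" if H: "H \<in> matrix_sum d" "sum_adj H = H" for H
  proof -
    define T where "T = P H + sum_smult (-1) (Q H)"
    have T: "T \<in> matrix_sum d" using H by (simp add: T_def)
    have "T \<in> D"
      using D expectation_mem[OF D P H(1)] expectation_mem[OF D Q H(1)]
      by (simp add: T_def unital_cstar_subalgebra_def)
    moreover have adjT: "sum_adj T = T"
      using H expectation_sa[OF D P H] expectation_sa[OF D Q H]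
      by (simp add: T_def sum_adj_add[of _ d] sum_adj_smult)
    ultimately have "Re (\<tau> (T * P H)) = Re (\<tau> (T * Q H))"
      using Re_trace_mult_expectation_eq[OF D P H] Re_trace_mult_expectation_eq[OF D Q H] by simp
    \<comment> \<open>Only the second factor is expanded; the first remains the test
      element.\<close>
    moreover have "\<tau> (T * T) = \<tau> (T * P H) - \<tau> (T * Q H)"
      using H T by (subst (2) T_def) (simp add: sum_mult_add_distrib[of _ d] sum_mult_smult[of _ d])
    ultimately have "Re (\<tau> (sum_adj T * T)) = 0" by (simp add: adjT)
    then have "\<tau> (sum_adj T * T) = 0"
      using positive[OF T] by (simp add: less_eq_complex_def complex_eq_iff)
    then have "T = sum_zero d" using T by (intro trace_eq_0D)
    then show ?thesis
      using H unfolding T_def by (metis sum_eq_if_diff_zero PQ)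
  qed
  have "P A = Q A" if A: "A \<in> matrix_sum d" for A
  proof -
    obtain R S where "R \<in> matrix_sum d" "S \<in> matrix_sum d" "sum_adj R = R" "sum_adj S = S"
      "A = R + sum_smult \<i> S"
      using sum_cartesian_decomposition[OF A] .
    then show ?thesis
      by (simp add: expectation_add[OF D P] expectation_add[OF D Q]
          expectation_smult[OF D P] expectation_smult[OF D Q] sa)
  qed
  \<comment> \<open>Agreement on the direct sum gives equality as functions because both maps are
    extensional.\<close>
  moreover have "P \<in> matrix_sum d \<rightarrow>\<^sub>E D" "Q \<in> matrix_sum d \<rightarrow>\<^sub>E D"
    using P Q by (auto simp: trace_expectation_def conditional_expectation_def)
  ultimately show ?thesis by (auto intro: PiE_ext)
qed

lemma cond_exp_eq:
  assumes "unital_cstar_subalgebra d D" and "trace_expectation D P"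
  shows "cond_exp d \<tau> D = P"
  unfolding cond_exp_def
  using assms trace_expectation_unique[OF assms(1)]
  by (intro the_equality) (auto simp: trace_expectation_def)

end

section \<open>Unitary conjugation\<close>

lemma unitary_elem_adj: "unitary_elem d U \<Longrightarrow> unitary_elem d (sum_adj U)"
  by (simp add: unitary_elem_def)

lemma unitary_conjugation_inverse:
  assumes U: "unitary_elem d U" and X: "X \<in> matrix_sum d"
  shows "sum_adj U * (U * X * sum_adj U) * U = X"
proof -
  have [simp]: "U \<in> matrix_sum d" using U by (simp add: unitary_elem_def)
  have "sum_adj U * (U * X * sum_adj U) * U = (sum_adj U * U) * X * (sum_adj U * U)"
    using X by (simp add: sum_mult_assoc[of _ d])
  then show ?thesis using U X by (simp add: unitary_elem_def)
qed

lemma op_norm_unitary_conjugation_le: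
  assumes U: "unitary_elem d U" and X: "X \<in> matrix_sum d"
  shows "op_norm (U * X * sum_adj U) \<le> op_norm X"
proof -
  have [simp]: "U \<in> matrix_sum d" using U by (simp add: unitary_elem_def)
  have "op_norm (U * X * sum_adj U) \<le> op_norm U * op_norm X * op_norm (sum_adj U)"
    using X by (meson U op_norm_mult_le op_norm_nonneg mult_right_mono order_trans sum_adj_closed
        sum_mult_closed unitary_elem_def)
  also have "\<dots> \<le> 1 * op_norm X * 1"
    using op_norm_unitary_le[OF U] op_norm_unitary_le[OF unitary_elem_adj[OF U]]
    by (intro mult_mono) (auto simp: op_norm_nonneg)
  finally show ?thesis by simp
qed

text \<open>Conjugation by \<open>U\<close> and its inverse, conjugation by the adjoint of
  \<open>U\<close>, are both contractions.\<close>

lemma op_norm_unitary_conjugation: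
  assumes U: "unitary_elem d U" and X: "X \<in> matrix_sum d"
  shows "op_norm (U * X * sum_adj U) = op_norm X"
proof (rule antisym)
  have "U * X * sum_adj U \<in> matrix_sum d" using U X by (simp add: unitary_elem_def)
  from op_norm_unitary_conjugation_le[OF unitary_elem_adj[OF U] this]
  show "op_norm X \<le> op_norm (U * X * sum_adj U)"
    by (simp add: unitary_conjugation_inverse[OF U X])
qed (rule op_norm_unitary_conjugation_le[OF U X])

lemma unitarily_equivalent_obtain:
  assumes "unitarily_equivalent d B C"
  obtains U where "unitary_elem d U" "C = (\<lambda>X. U * X * sum_adj U) ` B"
  using assms by (auto simp: unitarily_equivalent_def bij_betw_def)

text \<open>The adjoint of \<open>U\<close> implements the inverse bijection. Allows transfer
  results to be proved in one direction only.\<close>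

lemma unitarily_equivalent_sym:
  assumes "unitarily_equivalent d B C" and "B \<subseteq> matrix_sum d"
  shows "unitarily_equivalent d C B"
proof -
  obtain U where U: "unitary_elem d U" and C: "C = (\<lambda>X. U * X * sum_adj U) ` B"
    using assms(1) by (rule unitarily_equivalent_obtain)
  have inv: "sum_adj U * (U * X * sum_adj U) * U = X" if "X \<in> B" for X
    using unitary_conjugation_inverse[OF U] that assms(2) by blast
  have "bij_betw (\<lambda>X. sum_adj U * X * sum_adj (sum_adj U)) C B"
    by (rule bij_betwI[where g = "\<lambda>X. U * X * sum_adj U"]) (auto simp: C inv)
  then show ?thesis
    unfolding unitarily_equivalent_def using unitary_elem_adj[OF U] by blast
qed

section \<open>Transport of expectations and of the Frobenius-Rieffel norm\<close>

context faithful_trace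
begin

text \<open>Conjugate back by the adjoint of \<open>U\<close>, apply \<open>P\<close>, conjugate
  forward by \<open>U\<close>. Traciality makes conjugation preserve \<open>\<tau>\<close>, and
  conjugation is isometric; \<open>restrict\<close> supplies the extensionality that the definition
  demands.\<close>

lemma trace_expectation_conjugate:
  assumes B: "unital_cstar_subalgebra d B" and U: "unitary_elem d U"
    and P: "trace_expectation B P"
  shows "trace_expectation ((\<lambda>X. U * X * sum_adj U) ` B)
    (restrict (\<lambda>A. U * P (sum_adj U * A * U) * sum_adj U) (matrix_sum d))"
    (is "trace_expectation ?C ?Q")
proof -
  have Um [simp]: "U \<in> matrix_sum d" using U by (simp add: unitary_elem_def)
  note [simp] = expectation_closed[OF B P] expectation_add[OF B P] expectation_smult[OF B P]
  note distribs = sum_mult_add_distrib[of _ d] sum_add_mult_distrib[of _ d]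
    sum_smult_mult[of _ d] sum_mult_smult[of _ d]
  have C: "?C \<subseteq> matrix_sum d" using subalgebra_mem[OF B P] by auto
  have trace_conj: "\<tau> (U * X * sum_adj U) = \<tau> X" if "X \<in> matrix_sum d" for X
  proof -
    have "\<tau> (U * X * sum_adj U) = \<tau> (sum_adj U * (U * X))"
      using that by (intro trace_commute) auto
    also have "sum_adj U * (U * X) = X"
      using U that by (simp add: unitary_elem_def flip: sum_mult_assoc[of _ d])
    finally show ?thesis .
  qed
  have adj_conj: "U * (sum_adj U * A * U) * sum_adj U = A" if "A \<in> matrix_sum d" for A
    using unitary_conjugation_inverse[OF unitary_elem_adj[OF U] that] by simp
  have norm_adj_conj: "op_norm (sum_adj U * A * U) = op_norm A" if "A \<in> matrix_sum d" for A
    using op_norm_unitary_conjugation[OF unitary_elem_adj[OF U] that] by simp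
  have "?Q \<in> matrix_sum d \<rightarrow>\<^sub>E ?C"
    using expectation_mem[OF B P] by auto
  moreover have "?Q A = A" if "A \<in> ?C" for A
    using that subalgebra_mem[OF B P] expectation_id[OF B P]
    by (auto simp: unitary_conjugation_inverse[OF U])
  moreover have "op_norm (?Q A) \<le> op_norm A" if "A \<in> matrix_sum d" for A
    using that expectation_norm_le[OF B P, of "sum_adj U * A * U"]
    by (simp add: op_norm_unitary_conjugation[OF U] norm_adj_conj)
  moreover have "\<tau> (?Q A) = \<tau> A" if "A \<in> matrix_sum d" for A
  proof -
    have "\<tau> (?Q A) = \<tau> (sum_adj U * A * U)"
      using that by (simp add: trace_conj trace_expectation_eq[OF B P])
    also have "\<dots> = \<tau> A"
      using that trace_conj[of "sum_adj U * A * U"] by (simp add: adj_conj)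
    finally show ?thesis .
  qed
  moreover have "?Q (A + A') = ?Q A + ?Q A'" if "A \<in> matrix_sum d" "A' \<in> matrix_sum d" for A A'
    using that by (simp add: distribs)
  moreover have "?Q (sum_smult c A) = sum_smult c (?Q A)" if "A \<in> matrix_sum d" for c A
    using that by (simp add: distribs)
  ultimately show ?thesis
    unfolding trace_expectation_def conditional_expectation_def by blast
qed

text \<open>The element \<open>A' = U* A U\<close> has the operator norm of \<open>A\<close>, and
  its norm relative to \<open>B\<close> is that of \<open>A\<close> relative to \<open>C\<close>.
  Hence the bound for \<open>A'\<close> is the bound for \<open>A\<close>.\<close>

lemma frobenius_rieffel_lower_bound_transfer:
  assumes B: "unital_cstar_subalgebra d B" and C: "unital_cstar_subalgebra d C"
    and equiv: "unitarily_equivalent d B C" and \<mu>: "0 \<le> \<mu>"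
    and le: "\<And>A. A \<in> matrix_sum d \<Longrightarrow> \<mu> * op_norm A \<le> frobenius_rieffel_norm d \<tau> B A"
    and A: "A \<in> matrix_sum d"
  shows "\<mu> * op_norm A \<le> frobenius_rieffel_norm d \<tau> C A"
proof (cases "\<exists>P. trace_expectation B P")
  case True
  then obtain P where P: "trace_expectation B P" by blast
  obtain U where U: "unitary_elem d U" and C_eq: "C = (\<lambda>X. U * X * sum_adj U) ` B"
    using equiv by (rule unitarily_equivalent_obtain)
  have Um [simp]: "U \<in> matrix_sum d" using U by (simp add: unitary_elem_def)
  define A' where "A' = sum_adj U * A * U"
  have A' [simp]: "A' \<in> matrix_sum d" using A by (simp add: A'_def)
  have norm_A': "op_norm A' = op_norm A"
    using op_norm_unitary_conjugation[OF unitary_elem_adj[OF U] A] by (simp add: A'_def)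
  have "U * (sum_adj U * X) = X" if "X \<in> matrix_sum d" for X
    using U that by (simp add: unitary_elem_def flip: sum_mult_assoc[of _ d])
  then have square: "sum_adj A' * A' = sum_adj U * (sum_adj A * A) * U"
    using A by (simp add: A'_def sum_adj_mult[of _ d] sum_mult_assoc[of _ d])
  have "cond_exp d \<tau> C =
      restrict (\<lambda>A. U * P (sum_adj U * A * U) * sum_adj U) (matrix_sum d)"
    using cond_exp_eq[OF C] trace_expectation_conjugate[OF B U P] unfolding C_eq by blast
  then have "cond_exp d \<tau> C (sum_adj A * A) = U * P (sum_adj A' * A') * sum_adj U"
    using A by (simp add: square)
  then have "frobenius_rieffel_norm d \<tau> C A = frobenius_rieffel_norm d \<tau> B A'"
    by (simp add: frobenius_rieffel_norm_def cond_exp_eq[OF B P] op_norm_unitary_conjugation[OF U]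
        expectation_closed[OF B P])
  then show ?thesis using le[OF A'] by (simp add: norm_A')
next
  \<comment> \<open>Existence is never needed: otherwise both expectations are the same junk value of \<open>THE\<close>.\<close>
  case False
  have "\<not> trace_expectation C P" for P
  proof
    assume P: "trace_expectation C P"
    \<comment> \<open>An expectation onto \<open>C\<close> would be carried by the inverse
      conjugation to one onto \<open>B\<close>.\<close>
    have "unitarily_equivalent d C B"
      by (rule unitarily_equivalent_sym[OF equiv]) (use B in \<open>auto simp: unital_cstar_subalgebra_def\<close>)
    then obtain U where "unitary_elem d U" "B = (\<lambda>X. U * X * sum_adj U) ` C"
      by (rule unitarily_equivalent_obtain)
    then show False using trace_expectation_conjugate[OF C _ P] False by blast
  qed
  then have "cond_exp d \<tau> C = cond_exp d \<tau> B"
    using False by (simp add: cond_exp_def flip: trace_expectation_def)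
  then show ?thesis
    using le[OF A] by (simp add: frobenius_rieffel_norm_def)
qed

end

theorem lemma4p2:
  fixes d :: "'n::finite \<Rightarrow> nat"
    and \<tau> :: "('n \<Rightarrow> complex mat) \<Rightarrow> complex"
    and \<B> \<C> :: "('n \<Rightarrow> complex mat) set"
    and \<mu> :: real
  assumes "\<And>k. d k \<ge> 1"
    and "state d \<tau>" and "faithful d \<tau>" and "tracial d \<tau>"
    and "unital_cstar_subalgebra d \<B>" and "unital_cstar_subalgebra d \<C>"
    and "unitarily_equivalent d \<B> \<C>"
    and "\<mu> > 0"
  shows "(\<forall>A\<in>matrix_sum d. \<mu> * op_norm A \<le> frobenius_rieffel_norm d \<tau> \<B> A) \<longleftrightarrow>
         (\<forall>A\<in>matrix_sum d. \<mu> * op_norm A \<le> frobenius_rieffel_norm d \<tau> \<C> A)"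
proof -
  interpret faithful_trace d \<tau>
    by unfold_locales (use assms(2-4) in \<open>simp_all add: state_def\<close>)
  \<comment> \<open>With the equivalence reversed, the transfer lemma also gives the implication
    from (2) to (1).\<close>
  have "unitarily_equivalent d \<C> \<B>"
    by (rule unitarily_equivalent_sym[OF assms(7)])
      (use assms(5) in \<open>auto simp: unital_cstar_subalgebra_def\<close>)
  moreover have "0 \<le> \<mu>" using assms by simp
  ultimately show ?thesis
    using assms(5-7) frobenius_rieffel_lower_bound_transfer by blast
qed

end
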